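(* Let $n$ be a positive integer. The sum of $l(\mu)+\mu_1+\frac{1-(-1)^{r(\mu)}}{2}$ over all partitions $\mu$ of $n$ into distinct parts equals the sum of $2l(\lambda)$ over all partitions $\lambda$ of $n$ into odd parts; namely, $$\sum_{\mu\in D_n}\left(l(\mu)+\mu_1+\frac{1-(-1)^{r(\mu)}}{2}\right)=\sum_{\lambda\in O_n}2l(\lambda).$$
   Context: A partition $\lambda$ of a positive integer $n$ is a finite nonincreasing sequence of positive integers $\lambda_1,\lambda_2,\ldots,\lambda_r$ with $\sum_i\lambda_i=n$; the $\lambda_i$ are its parts, $\lambda_1$ is its largest part, and $l(\lambda)=r$ is its number of parts (its length). The rank of $\lambda$ is $r(\lambda)=\lambda_1-l(\lambda)$. $D_n$ is the set of partitions of $n$ into distinct parts, and $O_n$ is the set of partitions of $n$ into odd parts (repetitions allowed). *)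

theory Defs
  imports Complex_Main
begin

definition is_partition :: "nat list \<Rightarrow> nat \<Rightarrow> bool" where
  "is_partition xs n \<longleftrightarrow> sorted_wrt (\<ge>) xs \<and> (\<forall>x\<in>set xs. 0 < x) \<and> sum_list xs = n"

(* Since the parts are listed in nonincreasing order, the first entry is the largest part.
   The empty list partitions 0 only, so this is never applied to it when n > 0. *)
abbreviation largest_part :: "nat list \<Rightarrow> nat" where
  "largest_part xs \<equiv> hd xs"

(* The rank may be negative, hence the integer type. *)
definition partition_rank :: "nat list \<Rightarrow> int" where
  "partition_rank xs = int (largest_part xs) - int (length xs)"

definition distinct_partitions :: "nat \<Rightarrow> nat list set" where
  "distinct_partitions n = {xs. is_partition xs n \<and> distinct xs}"

definition odd_partitions :: "nat \<Rightarrow> nat list set" where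
  "odd_partitions n = {xs. is_partition xs n \<and> (\<forall>x\<in>set xs. odd x)}"

(* Finiteness guarantees that sums over these sets are genuine sums. *)
lemma finite_partitions: "finite {xs. is_partition xs n}"
proof (rule finite_subset)
  show "{xs. is_partition xs n} \<subseteq> {xs. set xs \<subseteq> {..n} \<and> length xs \<le> n}"
  proof safe
    fix xs x assume p: "is_partition xs n"
    show "x \<le> n" if "x \<in> set xs"
      using p member_le_sum_list[OF that] by (simp add: is_partition_def)
    have "length ys \<le> sum_list ys" if "\<forall>y\<in>set ys. 0 < y" for ys :: "nat list"
      using that by (induction ys) auto
    with p show "length xs \<le> n" by (auto simp: is_partition_def)
  qed
  show "finite {xs. set xs \<subseteq> {..n} \<and> length xs \<le> n}"
    by (rule finite_lists_length_le) simp
qed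

lemma finite_distinct_partitions: "finite (distinct_partitions n)"
  by (rule finite_subset[OF _ finite_partitions[of n]]) (auto simp: distinct_partitions_def)

lemma finite_odd_partitions: "finite (odd_partitions n)"
  by (rule finite_subset[OF _ finite_partitions[of n]]) (auto simp: odd_partitions_def)

end

theory Submission imports Defs begin

text \<open>Writing \<open>r\<close> for the rank of \<open>\<mu>\<close>, the summand on the left is
  \<open>2 \<mu>\<^sub>1 - 2 \<lfloor>r / 2\<rfloor>\<close>. The two terms are handled by two different bijections between partitions
  into distinct parts and partitions into odd parts.

  Sylvester's bijection \<open>\<mu> \<mapsto> \<nu>\<close> satisfies \<open>\<mu>\<^sub>1 = l(\<nu>) + (\<nu>\<^sub>1 - 1) / 2\<close>
  (\<open>hd_sylvester\<close>). A bijection obtained by iterating Dyson's map, \<open>\<nu> \<mapsto> \<mu>\<close>, satisfies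
  \<open>2 \<lfloor>r / 2\<rfloor> = \<nu>\<^sub>1 - 1\<close> (\<open>rank_dyson\<close>); this is Fine's refinement of Euler's theorem by the
  rank. Summing, the left side becomes the sum of \<open>2 l(\<nu>) + (\<nu>\<^sub>1 - 1)\<close> minus the sum of
  \<open>\<nu>\<^sub>1 - 1\<close>, both over partitions into odd parts, which is the right side. The cancellation happens
  only after summation: the terms \<open>\<nu>\<^sub>1 - 1\<close> come from different bijections.

  Surjectivity costs nothing. The two maps go in opposite directions between two finite sets, so
  as soon as both are injective the sets have equal size and both maps are bijections.\<close>

section \<open>Strictly decreasing lists of positive parts\<close>

definition strict_parts :: "nat list \<Rightarrow> bool" where
  "strict_parts xs \<longleftrightarrow> sorted_wrt (>) xs \<and> (\<forall>x\<in>set xs. 0 < x)"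

definition odd_parts :: "nat list \<Rightarrow> bool" where
  "odd_parts xs \<longleftrightarrow> sorted_wrt (\<ge>) xs \<and> (\<forall>x\<in>set xs. odd x)"

lemma strict_parts_Nil [simp]: "strict_parts []"
  by (simp add: strict_parts_def)

lemma strict_parts_Cons:
  "strict_parts (x # xs) \<longleftrightarrow> 0 < x \<and> (\<forall>y\<in>set xs. y < x) \<and> strict_parts xs"
  by (auto simp: strict_parts_def)

lemma odd_parts_Nil [simp]: "odd_parts []"
  by (simp add: odd_parts_def)

lemma odd_parts_Cons:
  "odd_parts (x # xs) \<longleftrightarrow> odd x \<and> (\<forall>y\<in>set xs. y \<le> x) \<and> odd_parts xs"
  by (auto simp: odd_parts_def)

lemma distinct_partitions_iff:
  "xs \<in> distinct_partitions n \<longleftrightarrow> strict_parts xs \<and> sum_list xs = n"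
proof -
  have "sorted_wrt (\<ge>) xs \<and> distinct xs \<longleftrightarrow> sorted_wrt (>) xs" for xs :: "nat list"
    by (induction xs) (auto simp: order.order_iff_strict)
  from this[of xs] show ?thesis
    unfolding distinct_partitions_def is_partition_def strict_parts_def by blast
qed

lemma odd_partitions_iff:
  "xs \<in> odd_partitions n \<longleftrightarrow> odd_parts xs \<and> sum_list xs = n"
  unfolding odd_partitions_def is_partition_def odd_parts_def using odd_pos by blast

section \<open>Iterating Dyson's map\<close>

definition remove_column :: "nat list \<Rightarrow> nat list" where
  "remove_column xs = filter (\<lambda>x. 0 < x) (map (\<lambda>x. x - 1) xs)"

lemma remove_column_simps [simp]:
  "remove_column [] = []"
  "remove_column (x # xs) = (if 1 < x then (x - 1) # remove_column xs else remove_column xs)"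
  by (auto simp: remove_column_def)

lemma set_remove_column: "y \<in> set (remove_column xs) \<longleftrightarrow> 0 < y \<and> Suc y \<in> set xs"
  by (induction xs) auto

lemma strict_parts_remove_column: "strict_parts xs \<Longrightarrow> strict_parts (remove_column xs)"
  by (induction xs) (auto simp: strict_parts_Cons set_remove_column less_diff_conv)

lemma sum_list_remove_column:
  "strict_parts xs \<Longrightarrow> sum_list (remove_column xs) + length xs = sum_list xs"
  by (induction xs) (auto simp: strict_parts_Cons)

text \<open>Only a smallest part \<open>1\<close> can disappear with the first column, and at most one part of a
  strict partition equals \<open>1\<close>.\<close>
lemma length_remove_column:
  assumes "strict_parts xs"
  shows "length xs = length (remove_column xs) \<or> length xs = Suc (length (remove_column xs))"
  using assms
proof (induction xs)
  case (Cons x xs)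
  then have "xs = []" if "x = 1"
    using that by (cases xs) (auto simp: strict_parts_Cons)
  with Cons show ?case by (cases "x = 1") (auto simp: strict_parts_Cons)
qed simp

lemma remove_column_inverse:
  assumes "strict_parts xs"
  shows "xs = map Suc (remove_column xs)
               @ replicate (length xs - length (remove_column xs)) 1"
  using assms
proof (induction xs)
  case (Cons x xs)
  then have "xs = []" if "x = 1"
    using that by (cases xs) (auto simp: strict_parts_Cons)
  with Cons show ?case by (cases "x = 1") (auto simp: strict_parts_Cons)
qed simp

text \<open>One step of Dyson's map removes the first column of the Young diagram and puts on top a row
  longer than that column by \<open>a\<close>, so the total grows by exactly \<open>a\<close>. Feeding in the parts of an odd
  partition from the smallest to the largest keeps each new row longer than the rows below it.\<close>
fun dyson :: "nat list \<Rightarrow> nat list" where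
  "dyson [] = []"
| "dyson (a # xs) = (length (dyson xs) + a) # remove_column (dyson xs)"

text \<open>The new rank is \<open>a\<close> or \<open>a - 1\<close>, according to whether a part disappeared with the column.\<close>
lemma rank_dyson_strict:
  assumes "strict_parts (dyson xs)"
  shows "hd (dyson (a # xs)) = length (dyson (a # xs)) + a
       \<or> Suc (hd (dyson (a # xs))) = length (dyson (a # xs)) + a"
  using length_remove_column[OF assms] by auto

text \<open>The new row exceeds the old first row minus one: by the rank estimate for the previous step,
  the old rank is at most the previous odd part, hence at most the present one. The induction
  therefore carries the rank bound along.\<close>
lemma strict_parts_dyson: "odd_parts xs \<Longrightarrow> strict_parts (dyson xs)"
proof -
  have "odd_parts xs \<Longrightarrow> strict_parts (dyson xs)
          \<and> (xs \<noteq> [] \<longrightarrow> hd (dyson xs) \<le> length (dyson xs) + hd xs)"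
  proof (induction xs)
    case (Cons a xs)
    then have a: "0 < a" and IH: "strict_parts (dyson xs)"
      by (auto simp: odd_parts_Cons odd_pos)
    have "y < length (dyson xs) + a" if y: "Suc y \<in> set (dyson xs)" for y
    proof (cases xs)
      case Nil
      with y show ?thesis by simp
    next
      case (Cons b ys)
      have "hd (dyson xs) \<le> length (dyson xs) + a"
        using Cons Cons.IH Cons.prems by (fastforce simp: odd_parts_Cons)
      moreover have "Suc y \<le> hd (dyson xs)"
        using y IH Cons by (auto simp: strict_parts_Cons)
      ultimately show ?thesis by simp
    qed
    then have "strict_parts (dyson (a # xs))"
      using a IH by (auto simp: strict_parts_Cons set_remove_column strict_parts_remove_column)
    moreover have "hd (dyson (a # xs)) \<le> length (dyson (a # xs)) + a"
      using rank_dyson_strict[OF IH, of a] by linarith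
    ultimately show ?case by simp
  qed simp
  then show "odd_parts xs \<Longrightarrow> strict_parts (dyson xs)" by simp
qed

lemma sum_list_dyson: "odd_parts xs \<Longrightarrow> sum_list (dyson xs) = sum_list xs"
proof (induction xs)
  case (Cons a xs)
  then have "odd_parts xs" by (simp add: odd_parts_Cons)
  with Cons.IH sum_list_remove_column[OF strict_parts_dyson, of xs] show ?case by simp
qed simp

lemma rank_dyson:
  assumes "odd_parts xs" "xs \<noteq> []"
  shows "hd (dyson xs) = length (dyson xs) + hd xs
       \<or> Suc (hd (dyson xs)) = length (dyson xs) + hd xs"
proof -
  obtain a ys where xs: "xs = a # ys" using assms(2) by (cases xs) auto
  then have "strict_parts (dyson ys)"
    using assms(1) by (simp add: odd_parts_Cons strict_parts_dyson)
  then show ?thesis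
    unfolding xs list.sel by (rule rank_dyson_strict)
qed

text \<open>The image determines the input: the rank determines the odd part \<open>a\<close>, the first row
  then gives the number of rows before the step, and this tells whether a part \<open>1\<close> was lost.\<close>
lemma dyson_inject:
  "odd_parts xs \<Longrightarrow> odd_parts ys \<Longrightarrow> dyson xs = dyson ys \<Longrightarrow> xs = ys"
proof (induction xs arbitrary: ys)
  case Nil
  then show ?case by (cases ys) auto
next
  case (Cons a xs)
  from Cons.prems obtain b zs where ys: "ys = b # zs" by (cases ys) auto
  have eq: "dyson (a # xs) = dyson (b # zs)" using Cons.prems ys by simp
  have odd: "odd a" "odd b" and parts: "odd_parts xs" "odd_parts zs"
    using Cons.prems ys by (auto simp: odd_parts_Cons)
  note strict = parts[THEN strict_parts_dyson]
  have "a = b \<or> a = Suc b \<or> b = Suc a"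
    using rank_dyson_strict[OF strict(1), of a, unfolded eq] rank_dyson_strict[OF strict(2), of b]
    by linarith
  then have ab: "a = b" using odd by auto
  then have "length (dyson xs) = length (dyson zs)"
      and "remove_column (dyson xs) = remove_column (dyson zs)"
    using eq by auto
  then have "dyson xs = dyson zs"
    by (metis strict remove_column_inverse)
  then show ?case using Cons.IH[OF parts] ab ys by simp
qed

section \<open>Sylvester's bijection\<close>

text \<open>In Sylvester's diagram an odd part \<open>2 j + 1\<close> is a row consisting of one box of weight \<open>1\<close>
  followed by \<open>j\<close> boxes of weight \<open>2\<close>. The outer hook takes one unit from each box of the first row
  and of the first column; the inner hook takes the units left in the first row and one unit from
  each box below it in the second column. What remains is again such a diagram.

  The function below is the inverse: it restores hooks of sizes \<open>a\<close> and \<open>b\<close> around \<open>xs\<close>. Each hook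
  adds one unit to every old row. The new first row has \<open>k = b - length xs\<close> boxes of weight \<open>2\<close>, since
  the inner hook meets this row and each old row; rows of length \<open>1\<close> bring the outer hook to
  size \<open>a\<close>. The value \<open>b = 0\<close> stands for a missing inner hook.\<close>
definition add_hooks :: "nat \<Rightarrow> nat \<Rightarrow> nat list \<Rightarrow> nat list" where
  "add_hooks a b xs =
     (2 * (b - length xs) + 1) # map (\<lambda>x. x + 2) xs @ replicate (a - Suc b) 1"

fun sylvester :: "nat list \<Rightarrow> nat list" where
  "sylvester [] = []"
| "sylvester [a] = add_hooks a 0 []"
| "sylvester (a # b # xs) = add_hooks a b (sylvester xs)"

definition hook_size :: "nat list \<Rightarrow> nat" where
  "hook_size xs = (if xs = [] then 0 else length xs + hd xs div 2)"

text \<open>The condition on \<open>b\<close> says that the inner hook encloses the outer hook of \<open>xs\<close>; it makes the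
  new first part larger than the lengthened old ones.\<close>
lemma add_hooks_props:
  assumes "odd_parts xs" "b < a" "xs \<noteq> [] \<Longrightarrow> hook_size xs < b"
  shows "odd_parts (add_hooks a b xs)"
    and "hook_size (add_hooks a b xs) = a"
    and "sum_list (add_hooks a b xs) = a + b + sum_list xs"
proof -
  have len: "length xs \<le> b"
    using assms(3) by (cases xs) (auto simp: hook_size_def)
  have first: "x + 2 \<le> 2 * (b - length xs) + 1" if "x \<in> set xs" for x
  proof -
    have "x \<le> hd xs" "odd (hd xs)" "xs \<noteq> []"
      using that assms(1) by (cases xs; auto simp: odd_parts_Cons)+
    with assms(3) show ?thesis by (auto simp: hook_size_def elim!: oddE)
  qed
  have ones: "sorted_wrt (\<ge>) (replicate m (1::nat))" for m
    by (induction m) auto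
  from first show "odd_parts (add_hooks a b xs)"
    using assms(1) ones[of "a - Suc b"]
    by (auto simp: add_hooks_def odd_parts_def sorted_wrt_append sorted_wrt_map)
  show "hook_size (add_hooks a b xs) = a"
    using len assms(2) by (simp add: hook_size_def add_hooks_def)
  have "sum_list (map (\<lambda>x. x + 2) xs) = sum_list xs + 2 * length xs"
    by (induction xs) auto
  then show "sum_list (add_hooks a b xs) = a + b + sum_list xs"
    using len assms(2) by (simp add: add_hooks_def sum_list_replicate)
qed

text \<open>The parts lengthened by \<open>2\<close> are the ones after the first that exceed \<open>1\<close>. They
  determine \<open>xs\<close>; the first part then determines \<open>b\<close>, and the length determines \<open>a\<close>.\<close>
lemma add_hooks_inject:
  assumes "odd_parts xs" "odd_parts ys" "b < a" "d < c"
      and "length xs \<le> b" "length ys \<le> d"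
      and eq: "add_hooks a b xs = add_hooks c d ys"
  shows "a = c \<and> b = d \<and> xs = ys"
proof -
  have "filter (\<lambda>x. 1 < x) (tl (add_hooks p q zs)) = map (\<lambda>x. x + 2) zs" for p q zs
    by (simp add: add_hooks_def filter_replicate)
  then have "map (\<lambda>x. x + 2) xs = map (\<lambda>x. x + 2) ys"
    using eq by metis
  then have xy: "xs = ys"
    by (simp add: inj_map_eq_map inj_def)
  moreover have bd: "b = d"
    using eq assms(5,6) xy by (auto simp: add_hooks_def)
  moreover have "length (add_hooks a b xs) = length (add_hooks c d ys)"
    using eq by simp
  then have "a = c"
    using assms(3,4) xy bd by (simp add: add_hooks_def)
  ultimately show ?thesis by simp
qed

lemma sylvester_props:
  assumes "strict_parts xs"
  shows "odd_parts (sylvester xs)"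
    and "sum_list (sylvester xs) = sum_list xs"
    and "xs \<noteq> [] \<Longrightarrow> hook_size (sylvester xs) = hd xs"
    and "sylvester xs = [] \<longleftrightarrow> xs = []"
proof -
  show empty: "sylvester ys = [] \<longleftrightarrow> ys = []" for ys
    by (cases ys rule: sylvester.cases) (auto simp: add_hooks_def)
  have "odd_parts (sylvester xs) \<and> sum_list (sylvester xs) = sum_list xs
      \<and> (xs \<noteq> [] \<longrightarrow> hook_size (sylvester xs) = hd xs)"
    using assms
  proof (induction xs rule: sylvester.induct)
    case (2 a)
    then show ?case
      using add_hooks_props[of "[]" 0 a] by (simp add: strict_parts_Cons)
  next
    case (3 a b xs)
    then have *: "b < a" "odd_parts (sylvester xs)" "sum_list (sylvester xs) = sum_list xs"
      by (auto simp: strict_parts_Cons)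
    have "hook_size (sylvester xs) < b" if "sylvester xs \<noteq> []"
      using that 3 empty[of xs] by (cases xs) (auto simp: strict_parts_Cons)
    from add_hooks_props[OF *(2,1) this] *(3) show ?case by simp
  qed simp
  then show "odd_parts (sylvester xs)" "sum_list (sylvester xs) = sum_list xs"
      "xs \<noteq> [] \<Longrightarrow> hook_size (sylvester xs) = hd xs"
    by simp_all
qed

lemma hd_sylvester:
  assumes "strict_parts xs" "xs \<noteq> []"
  shows "hd xs = length (sylvester xs) + hd (sylvester xs) div 2"
  using sylvester_props(3,4)[OF assms(1)] assms(2) by (simp add: hook_size_def)

text \<open>The inner hook is at least as long as the number of rows it encloses, so the truncated
  subtraction in \<open>add_hooks\<close> loses nothing.\<close>
lemma length_sylvester_le:
  assumes "strict_parts (b # xs)"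
  shows "length (sylvester xs) \<le> b"
proof (cases xs)
  case (Cons c ys)
  then show ?thesis
    using hd_sylvester[of xs] assms by (auto simp: strict_parts_Cons)
qed simp

lemma sylvester_inject:
  "strict_parts xs \<Longrightarrow> strict_parts ys \<Longrightarrow> sylvester xs = sylvester ys \<Longrightarrow> xs = ys"
proof (induction xs arbitrary: ys rule: sylvester.induct)
  case 1
  then show ?case using sylvester_props(4)[of ys] by simp
next
  case (2 a)
  show ?case
  proof (cases ys rule: sylvester.cases)
    case 1
    with 2 show ?thesis by (simp add: add_hooks_def)
  next
    case (2 c)
    with "2.prems" show ?thesis
      using add_hooks_inject[of "[]" "[]" 0 a 0 c] by (simp add: strict_parts_Cons)
  next
    case (3 c d zs)
    then have "strict_parts (d # zs)" "0 < d" "0 < a" "d < c" "strict_parts zs"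
      using "2.prems" by (auto simp: strict_parts_Cons)
    then show ?thesis
      using add_hooks_inject[of "[]" "sylvester zs" 0 a d c] "2.prems"(3) 3
        length_sylvester_le[of d zs] sylvester_props(1)[of zs] by simp
  qed
next
  case (3 a b xs)
  then have x: "strict_parts (b # xs)" "0 < b" "b < a" "strict_parts xs"
    by (auto simp: strict_parts_Cons)
  note hx = length_sylvester_le[OF x(1)] sylvester_props(1)[OF x(4)]
  show ?case
  proof (cases ys rule: sylvester.cases)
    case 1
    with 3 show ?thesis by (simp add: add_hooks_def)
  next
    case (2 c)
    then show ?thesis
      using add_hooks_inject[of "sylvester xs" "[]" b a 0 c] "3.prems" x hx
      by (simp add: strict_parts_Cons)
  next
    case (3 c d zs)
    then have y: "strict_parts (d # zs)" "d < c" "strict_parts zs"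
      using "3.prems" by (auto simp: strict_parts_Cons)
    have "a = c \<and> b = d \<and> sylvester xs = sylvester zs"
      using add_hooks_inject[of "sylvester xs" "sylvester zs" b a d c] "3.prems"(3) 3 x hx
        length_sylvester_le[OF y(1)] sylvester_props(1)[OF y(3)] y by simp
    then show ?thesis
      using "3.IH"[OF x(4) y(3)] 3 by simp
  qed
qed

section \<open>Comparing the two bijections\<close>

lemma bij_betw_opposite_injections:
  assumes "finite A" "finite B" "inj_on f A" "f ` A \<subseteq> B" "inj_on g B" "g ` B \<subseteq> A"
  shows "bij_betw f A B" and "bij_betw g B A"
proof -
  have "card A = card B"
    using card_inj_on_le[OF assms(3,4,2)] card_inj_on_le[OF assms(5,6,1)] by simp
  then show "bij_betw f A B" "bij_betw g B A"
    using assms card_image[OF assms(3)] card_image[OF assms(5)]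
    by (auto simp: bij_betw_def card_subset_eq)
qed

lemma bij_betw_sylvester: "bij_betw sylvester (distinct_partitions n) (odd_partitions n)"
  and bij_betw_dyson: "bij_betw dyson (odd_partitions n) (distinct_partitions n)"
proof -
  have "inj_on sylvester (distinct_partitions n)" "inj_on dyson (odd_partitions n)"
    by (meson inj_onI distinct_partitions_iff odd_partitions_iff sylvester_inject dyson_inject)+
  moreover have "sylvester ` distinct_partitions n \<subseteq> odd_partitions n"
    by (auto simp: distinct_partitions_iff odd_partitions_iff sylvester_props)
  moreover have "dyson ` odd_partitions n \<subseteq> distinct_partitions n"
    by (auto simp: distinct_partitions_iff odd_partitions_iff strict_parts_dyson sum_list_dyson)
  ultimately show "bij_betw sylvester (distinct_partitions n) (odd_partitions n)"
      "bij_betw dyson (odd_partitions n) (distinct_partitions n)"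
    using bij_betw_opposite_injections finite_distinct_partitions finite_odd_partitions
    by metis+
qed

definition statistic :: "nat list \<Rightarrow> real" where
  "statistic xs = real (length xs) + real (hd xs) + (1 - (-1) powi (partition_rank xs)) / 2"

text \<open>For rank \<open>r\<close> the statistic is \<open>2 \<mu>\<^sub>1 - 2 \<lfloor>r / 2\<rfloor>\<close>. Here \<open>r\<close> is one of the consecutive numbers
  \<open>hd xs - 1\<close> and \<open>hd xs\<close>, and since the first of them is even, it equals \<open>2 \<lfloor>r / 2\<rfloor>\<close> in both cases.\<close>
lemma statistic_dyson:
  assumes "odd_parts xs" "xs \<noteq> []"
  shows "statistic (dyson xs) = 2 * real (hd (dyson xs)) - real (hd xs - 1)"
proof -
  have "odd (hd xs)" using assms by (cases xs) (auto simp: odd_parts_Cons)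
  then obtain k where k: "hd xs = 2 * k + 1" by (rule oddE)
  from rank_dyson[OF assms] show ?thesis
  proof
    assume h: "hd (dyson xs) = length (dyson xs) + hd xs"
    then have "partition_rank (dyson xs) = int (2 * k + 1)"
      by (simp add: partition_rank_def k)
    then have "(-1) powi partition_rank (dyson xs) = (-1 :: real)"
      by (simp only: power_int_of_nat) simp
    then show ?thesis unfolding statistic_def by (simp add: h k)
  next
    assume h: "Suc (hd (dyson xs)) = length (dyson xs) + hd xs"
    then have hd: "hd (dyson xs) = length (dyson xs) + 2 * k" by (simp add: k)
    then have "partition_rank (dyson xs) = int (2 * k)"
      by (simp add: partition_rank_def)
    then have "(-1) powi partition_rank (dyson xs) = (1 :: real)"
      by (simp only: power_int_of_nat) simp
    then show ?thesis unfolding statistic_def by (simp add: hd k)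
  qed
qed

theorem theorem2p3:
  fixes n :: nat
  assumes "n > 0"
  shows "(\<Sum>\<mu>\<in>distinct_partitions n.
            real (length \<mu>) + real (largest_part \<mu>)
              + (1 - (-1) powi (partition_rank \<mu>)) / 2)
       = (\<Sum>\<nu>\<in>odd_partitions n. 2 * real (length \<nu>))"
proof -
  let ?D = "distinct_partitions n" and ?O = "odd_partitions n"
  have largest: "(\<Sum>\<mu>\<in>?D. 2 * real (hd \<mu>))
      = (\<Sum>\<nu>\<in>?O. 2 * real (length \<nu>) + real (hd \<nu> - 1))"
    unfolding sum.reindex_bij_betw[OF bij_betw_sylvester, symmetric]
  proof (rule sum.cong[OF refl])
    fix \<mu> assume "\<mu> \<in> ?D"
    then have \<mu>: "strict_parts \<mu>" "\<mu> \<noteq> []"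
      using assms by (auto simp: distinct_partitions_iff)
    then have "odd (hd (sylvester \<mu>))"
      using sylvester_props(1,4)[of \<mu>] by (cases "sylvester \<mu>") (auto simp: odd_parts_Cons)
    then show "2 * real (hd \<mu>)
        = 2 * real (length (sylvester \<mu>)) + real (hd (sylvester \<mu>) - 1)"
      using hd_sylvester[OF \<mu>] by (auto elim!: oddE)
  qed
  have "(\<Sum>\<mu>\<in>?D. statistic \<mu>) = (\<Sum>\<nu>\<in>?O. statistic (dyson \<nu>))"
    by (rule sum.reindex_bij_betw[OF bij_betw_dyson, symmetric])
  also have "\<dots> = (\<Sum>\<nu>\<in>?O. 2 * real (hd (dyson \<nu>)) - real (hd \<nu> - 1))"
    using assms by (intro sum.cong refl statistic_dyson) (auto simp: odd_partitions_iff)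
  also have "\<dots> = (\<Sum>\<nu>\<in>?O. 2 * real (hd (dyson \<nu>))) - (\<Sum>\<nu>\<in>?O. real (hd \<nu> - 1))"
    by (rule sum_subtractf)
  also have "(\<Sum>\<nu>\<in>?O. 2 * real (hd (dyson \<nu>))) = (\<Sum>\<mu>\<in>?D. 2 * real (hd \<mu>))"
    by (rule sum.reindex_bij_betw[OF bij_betw_dyson])
  also have "\<dots> - (\<Sum>\<nu>\<in>?O. real (hd \<nu> - 1)) = (\<Sum>\<nu>\<in>?O. 2 * real (length \<nu>))"
    by (simp add: largest sum.distrib)
  finally show ?thesis by (simp add: statistic_def)
qed

end
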